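(* Let $L>0$ and $T>0$. Let $f\in\mathcal R_T^L(0)$, $F=\mathscr Ff$ and $G=\Psi F$. Then $G$ can be extended to an entire function $G_e$ on $\mathbb C$ of order $\le1$ and type $\le T$. Moreover, $F$ can also be extended to an entire function $F_e$ on $\mathbb C^2$ and $$F_e(s)=G_e(s_1^2+s_2^2),\quad s=(s_1,s_2)\in\mathbb C^2,$$ and $F_e$ is of order $\le2$ and type $\le T$. In addition, $$|F_e(s)|\le|G_e(s_1^2+s_2^2)|\le\frac L\pi\,\frac{e^{T|s|^2}-1}{|s|^2},\quad s\in\mathbb C^2.$$
   Context: $\mathbb R_+=(0,+\infty)$; function spaces are complex. $\mathscr F$ is the unitary Fourier transform on $L^2(\mathbb R^2)$, $(\mathscr Ff)(\sigma)=\frac1{2\pi}\iint f(x)e^{-i\langle x,\sigma\rangle}dx$. $\mathcal H=\{f\in L^2(\mathbb R^2): \exists g\in L^2(\mathbb R_+),\ f(x)=g(|x|^2)\text{ a.e.}\}$, and $\Psi:\mathcal H\to L^2(\mathbb R_+)$ maps $f$ to this $g$; $\mathscr F$ maps $\mathcal H$ onto $\mathcal H$. $\mathcal R_T^L(0)\subset\mathcal H$ is the set of functions of the form $$\mathcal W_u(x,T)=-\frac1\pi\int_0^T\frac1{2\xi}e^{-\frac{|x|^2}{4\xi}}u(T-\xi)\,d\xi,\quad u\in L^\infty(0,T),\ \|u\|_{L^\infty(0,T)}\le L .$$ An entire function $E$ (on $\mathbb C$ or $\mathbb C^2$) is said to be of order $\le p$ and type $\le T$ if for every $\varepsilon>0$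 there is $C_\varepsilon$ with $|E(z)|\le C_\varepsilon e^{(T+\varepsilon)|z|^p}$ for all $z$. "Extended" means that the entire function agrees a.e. with the given function on $\mathbb R_+$ (resp. $\mathbb R^2$). For $s\in\mathbb C^2$, $|s|^2=|s_1|^2+|s_2|^2$; at $s=0$ the quotient $\frac{e^{T|s|^2}-1}{|s|^2}$ is understood as its limit $T$. *)

theory Defs
  imports "HOL-Analysis.Analysis" "HOL-Probability.Essential_Supremum"
begin

text \<open>Elements of an \<open>L\<^sup>p\<close> space are given by representatives: complex functions that are measurable
  with respect to Lebesgue measure (on the whole space or restricted to an interval). Identities
  between elements are almost-everywhere identities.\<close>

definition L2_on :: "'a measure \<Rightarrow> ('a \<Rightarrow> complex) set" where
  "L2_on M = {f \<in> borel_measurable M. integrable M (\<lambda>x. (norm (f x))\<^sup>2)}"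

definition Linf_norm :: "'a measure \<Rightarrow> ('a \<Rightarrow> complex) \<Rightarrow> ereal" where
  "Linf_norm M u = esssup M (\<lambda>x. ereal (norm (u x)))"

definition Linf_on :: "'a measure \<Rightarrow> ('a \<Rightarrow> complex) set" where
  "Linf_on M = {u \<in> borel_measurable M. Linf_norm M u < \<infinity>}"

definition fourier_integral :: "(real^2 \<Rightarrow> complex) \<Rightarrow> real^2 \<Rightarrow> complex" where
  "fourier_integral f \<sigma> =
     1 / (2 * complex_of_real pi) *
       (LINT x|lebesgue. f x * exp (- (\<i> * complex_of_real (x \<bullet> \<sigma>))))"

text \<open>\<open>fourier_L2 f F\<close>: the square-integrable function \<open>F\<close> represents the unitary Fourier transform
  of \<open>f\<close>. For a general square-integrable \<open>f\<close> the Fourier integral need not converge, so it is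
  read, as in Plancherel's theorem, as the limit in \<open>L\<^sup>2\<close> of the integrals over the discs of
  radius \<open>R\<close> as \<open>R\<close> tends to infinity. This determines \<open>F\<close> up to a null set.\<close>

definition fourier_L2 :: "(real^2 \<Rightarrow> complex) \<Rightarrow> (real^2 \<Rightarrow> complex) \<Rightarrow> bool" where
  "fourier_L2 f F \<longleftrightarrow>
     f \<in> L2_on lebesgue \<and> F \<in> L2_on lebesgue \<and>
     ((\<lambda>R. \<integral>\<^sup>+ \<sigma>. ennreal ((norm (fourier_integral (\<lambda>x. indicator (cball 0 R) x * f x) \<sigma> - F \<sigma>))\<^sup>2)
             \<partial>lebesgue) \<longlongrightarrow> 0) at_top"

text \<open>\<open>radial_profile f g\<close>: \<open>f\<close> belongs to the space \<open>\<H>\<close> of radial square-integrable functions and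
  \<open>g\<close> represents \<open>\<Psi> f\<close>. Note that \<open>g\<close> is a function of the square of the radius.\<close>

definition radial_profile :: "(real^2 \<Rightarrow> complex) \<Rightarrow> (real \<Rightarrow> complex) \<Rightarrow> bool" where
  "radial_profile f g \<longleftrightarrow>
     f \<in> L2_on lebesgue \<and> g \<in> L2_on (lebesgue_on {0<..}) \<and>
     (AE x in lebesgue. f x = g ((norm x)\<^sup>2))"

definition heat_control :: "(real \<Rightarrow> complex) \<Rightarrow> real^2 \<Rightarrow> real \<Rightarrow> complex" where
  "heat_control u x T =
     - (1 / complex_of_real pi) *
       (LINT \<xi>|lebesgue_on {0<..<T}.
          complex_of_real (1 / (2 * \<xi>) * exp (- (norm x)\<^sup>2 / (4 * \<xi>))) * u (T - \<xi>))"

text \<open>The reachable set from the zero state in time \<open>T\<close>, as a set of representatives.\<close>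

definition reachable_from_0 :: "real \<Rightarrow> real \<Rightarrow> (real^2 \<Rightarrow> complex) set" where
  "reachable_from_0 L T =
     {f. \<exists>u \<in> Linf_on (lebesgue_on {0<..<T}).
           Linf_norm (lebesgue_on {0<..<T}) u \<le> ereal L \<and>
           (AE x in lebesgue. f x = heat_control u x T)}"

text \<open>Entire functions of several complex variables: real Frechet differentiable everywhere, with
  complex-linear derivative.\<close>

definition entire_several :: "(complex^'n \<Rightarrow> complex) \<Rightarrow> bool" where
  "entire_several f \<longleftrightarrow>
     (\<forall>z. \<exists>D. (f has_derivative D) (at z) \<and> (\<forall>c h. D (c *s h) = c * D h))"

definition order_type_le :: "('a::real_normed_vector \<Rightarrow> complex) \<Rightarrow> real \<Rightarrow> real \<Rightarrow> bool" where
  "order_type_le E p T \<longleftrightarrow>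
     (\<forall>\<epsilon>>0. \<exists>C. \<forall>z. norm (E z) \<le> C * exp ((T + \<epsilon>) * norm z powr p))"

end

theory Submission
  imports Defs "HOL-Probability.Probability" "HOL-Complex_Analysis.Cauchy_Integral_Formula"
begin

text \<open>The function \<open>exp (- |x|\<^sup>2 / (4 \<xi>)) / (2 \<xi>)\<close> is \<open>2 \<pi>\<close> times a product of two centred normal
  densities of variance \<open>2 \<xi>\<close>, so its unitary Fourier transform is \<open>exp (- \<xi> |\<sigma>|\<^sup>2)\<close>. By Fubini,
  \<open>\<F> f(\<sigma>)\<close> is \<open>- 1/\<pi>\<close> times the integral of \<open>exp (- z \<xi>) u(T - \<xi>)\<close> over \<open>0 < \<xi> < T\<close> at
  \<open>z = |\<sigma>|\<^sup>2\<close>. This integral over a bounded interval is entire in \<open>z\<close>, and estimating the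
  integrand by \<open>L exp (|z| \<xi>)\<close> gives all the bounds.\<close>

section \<open>Planar Lebesgue measure as a product, and Fourier integrals of Gaussians\<close>

definition vec2 :: "real \<times> real \<Rightarrow> real^2" where
  "vec2 p = vector [fst p, snd p]"

lemma vec2_nth [simp]: "vec2 p $ 1 = fst p" "vec2 p $ 2 = snd p"
  by (simp_all add: vec2_def)

lemma vec2_measurable [measurable]:
  "vec2 \<in> borel_measurable (lborel \<Otimes>\<^sub>M lborel)"
proof -
  have eq: "vec2 = (\<lambda>p. fst p *\<^sub>R axis 1 1 + snd p *\<^sub>R axis 2 1)"
    by (simp add: fun_eq_iff vec_eq_iff forall_2 axis_def)
  show ?thesis unfolding eq by simp
qed

text \<open>Lebesgue measure is determined by its values on boxes, and \<open>vec2\<close> pulls a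
  box back to a product of two intervals. Through this identity the pair versions of Fubini's
  theorem apply to \<open>real^2\<close>.\<close>

lemma lborel_eq_distr_vec2:
  "(lborel :: (real^2) measure) = distr (lborel \<Otimes>\<^sub>M lborel) borel vec2"
proof (rule lborel_eqI)
  fix l u :: "real^2"
  assume le: "\<And>b. b \<in> Basis \<Longrightarrow> l \<bullet> b \<le> u \<bullet> b"
  have le': "l $ i \<le> u $ i" for i
    using le[of "axis i 1"] by (auto simp: inner_axis)
  have B: "(Basis :: (real^2) set) = {axis 1 1, axis 2 1}"
    by (auto simp: Basis_vec_def UNIV_2)
  have "vec2 -` box l u \<inter> space (lborel \<Otimes>\<^sub>M lborel)
      = {l $ 1 <..< u $ 1} \<times> {l $ 2 <..< u $ 2}"
    by (auto simp: mem_box B inner_axis space_pair_measure)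
  then have "emeasure (distr (lborel \<Otimes>\<^sub>M lborel) borel vec2) (box l u)
      = emeasure (lborel \<Otimes>\<^sub>M lborel) ({l $ 1 <..< u $ 1} \<times> {l $ 2 <..< u $ 2})"
    by (subst emeasure_distr[OF vec2_measurable]) simp_all
  also have "\<dots> = ennreal ((u $ 1 - l $ 1) * (u $ 2 - l $ 2))"
    using le' by (subst lborel.emeasure_pair_measure_Times) (auto simp: ennreal_mult)
  also have "(u $ 1 - l $ 1) * (u $ 2 - l $ 2) = (\<Prod>b\<in>Basis. (u - l) \<bullet> b)"
    by (simp add: B axis_eq_axis inner_axis)
  finally show "emeasure (distr (lborel \<Otimes>\<^sub>M lborel) borel vec2) (box l u)
      = ennreal (\<Prod>b\<in>Basis. (u - l) \<bullet> b)" .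
qed simp

text \<open>Rescaling reduces the claim to the characteristic function of the standard normal law.
  That function is built on \<open>exp (\<i> * t * x)\<close> with a plus sign, hence its argument
  \<open>- (\<sigma> * t)\<close>.\<close>

lemma fourier_normal_density:
  assumes "\<sigma> > 0"
  shows "(LINT x|lborel. complex_of_real (normal_density 0 \<sigma> x) * exp (- (\<i> * complex_of_real (x * t))))
       = complex_of_real (exp (- (\<sigma> * t)\<^sup>2 / 2))"
proof -
  have "complex_of_real (exp (- (\<sigma> * t)\<^sup>2 / 2)) = char std_normal_distribution (- (\<sigma> * t))"
    by (simp add: char_std_normal_distribution)
  also have "\<dots> = (LINT x|lborel. std_normal_density x *\<^sub>R exp (\<i> * complex_of_real (- (\<sigma> * t) * x)))"
    unfolding char_def by (subst integral_density) auto
  \<comment> \<open>The standard density at \<open>x\<close> is \<open>\<sigma>\<close> times the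
    density of deviation \<open>\<sigma>\<close> at \<open>\<sigma> * x\<close>. The summand
    \<open>0 +\<close> matches the affine change of variables used next.\<close>
  also have "\<dots> = \<sigma> *\<^sub>R (LINT x|lborel. normal_density 0 \<sigma> (0 + \<sigma> * x) *\<^sub>R exp (- (\<i> * complex_of_real ((0 + \<sigma> * x) * t))))"
    unfolding integral_scaleR_right[symmetric] using assms by (intro Bochner_Integration.integral_cong)
      (auto simp: normal_density_def real_sqrt_mult power_mult_distrib mult_ac)
  also have "\<dots> = (LINT x|lborel. normal_density 0 \<sigma> x *\<^sub>R exp (- (\<i> * complex_of_real (x * t))))"
    using assms lborel_integral_real_affine[of \<sigma> "\<lambda>x. normal_density 0 \<sigma> x *\<^sub>R exp (- (\<i> * complex_of_real (x * t)))" 0]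
    by simp
  finally show ?thesis by (simp add: scaleR_conv_of_real)
qed

lemma lborel_vec2_product:
  fixes f g :: "real \<Rightarrow> complex"
  assumes f: "integrable lborel f" and g: "integrable lborel g"
  shows "integrable (lborel :: (real^2) measure) (\<lambda>x. f (x $ 1) * g (x $ 2))"
    and "(LINT x|lborel. f ((x :: real^2) $ 1) * g (x $ 2)) = integral\<^sup>L lborel f * integral\<^sup>L lborel g"
proof -
  have m: "(\<lambda>x :: real^2. f (x $ 1) * g (x $ 2)) \<in> borel_measurable borel"
    using f g by simp
  have i: "integrable (lborel \<Otimes>\<^sub>M lborel) (\<lambda>p. f (fst p) * g (snd p))"
    using f g by (intro lborel_pair.Fubini_integrable) (auto simp: norm_mult)
  then show "integrable (lborel :: (real^2) measure) (\<lambda>x. f (x $ 1) * g (x $ 2))"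
    using m unfolding lborel_eq_distr_vec2 by (subst integrable_distr_eq) (auto simp: case_prod_beta')
  have "(LINT x|lborel. f ((x :: real^2) $ 1) * g (x $ 2))
      = (LINT p|(lborel \<Otimes>\<^sub>M lborel). f (fst p) * g (snd p))"
    using m unfolding lborel_eq_distr_vec2 by (subst integral_distr) (auto simp: case_prod_beta')
  also have "\<dots> = integral\<^sup>L lborel f * integral\<^sup>L lborel g"
    using lborel_pair.integral_fst'[OF i] by simp
  finally show "(LINT x|lborel. f ((x :: real^2) $ 1) * g (x $ 2)) = integral\<^sup>L lborel f * integral\<^sup>L lborel g" .
qed

section \<open>The two-dimensional heat kernel and its Fourier transform\<close>

text \<open>This is \<open>2 * pi\<close> times the probability-normalised heat kernel at time
  \<open>\<xi>\<close>, so the factor \<open>1 / (2 * pi)\<close> of the unitary Fourier transform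
  cancels exactly.\<close>

definition heat_kernel :: "real \<Rightarrow> real^2 \<Rightarrow> real" where
  "heat_kernel \<xi> x = 1 / (2 * \<xi>) * exp (- (norm x)\<^sup>2 / (4 * \<xi>))"

lemma norm_real2: "(norm (x :: real^2))\<^sup>2 = (x $ 1)\<^sup>2 + (x $ 2)\<^sup>2"
  by (simp add: norm_vec_def L2_set_def sum_2)

lemma heat_kernel_eq:
  assumes "\<xi> > 0"
  shows "heat_kernel \<xi> x = 2 * pi * (normal_density 0 (sqrt (2 * \<xi>)) (x $ 1) * normal_density 0 (sqrt (2 * \<xi>)) (x $ 2))"
proof -
  have nd: "normal_density 0 (sqrt (2 * \<xi>)) y = exp (- y\<^sup>2 / (4 * \<xi>)) / sqrt (4 * pi * \<xi>)" for y
    using assms by (simp add: normal_density_def mult.commute mult.left_commute)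
  have "sqrt (4 * pi * \<xi>) * sqrt (4 * pi * \<xi>) = 4 * pi * \<xi>"
    using assms by simp
  moreover have "exp (- (x $ 1)\<^sup>2 / (4 * \<xi>)) * exp (- (x $ 2)\<^sup>2 / (4 * \<xi>)) = exp (- (norm x)\<^sup>2 / (4 * \<xi>))"
    unfolding exp_add[symmetric] norm_real2 add_divide_distrib[symmetric] by simp
  ultimately show ?thesis
    unfolding nd heat_kernel_def times_divide_times_eq by simp
qed

lemma heat_kernel_fourier:
  assumes "\<xi> > 0"
  shows "integrable lborel (\<lambda>x. complex_of_real (heat_kernel \<xi> x) * exp (- (\<i> * complex_of_real (x \<bullet> s))))" (is ?A)
    and "(LINT x|lborel. complex_of_real (heat_kernel \<xi> x) * exp (- (\<i> * complex_of_real (x \<bullet> s))))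
      = complex_of_real (2 * pi * exp (- (\<xi> * (norm s)\<^sup>2)))" (is ?B)
proof -
  define \<sigma> where "\<sigma> = sqrt (2 * \<xi>)"
  have \<sigma>: "\<sigma> > 0" "\<sigma>\<^sup>2 = 2 * \<xi>" using assms by (auto simp: \<sigma>_def)
  define h where "h t x = complex_of_real (normal_density 0 \<sigma> x) * exp (- (\<i> * complex_of_real (x * t)))" for t x
  have h: "integrable lborel (h t)" for t
  proof (rule Bochner_Integration.integrable_bound)
    show "integrable lborel (normal_density 0 \<sigma>)" using \<sigma> by simp
    show "h t \<in> borel_measurable lborel" unfolding h_def by simp
    show "AE x in lborel. norm (h t x) \<le> norm (normal_density 0 \<sigma> x)"
      by (simp add: h_def norm_mult)
  qed
  have eq: "complex_of_real (heat_kernel \<xi> x) * exp (- (\<i> * complex_of_real (x \<bullet> s)))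
     = 2 * pi * (h (s $ 1) (x $ 1) * h (s $ 2) (x $ 2))" for x
  proof -
    have e: "exp (- (\<i> * complex_of_real (x \<bullet> s)))
      = exp (- (\<i> * complex_of_real (x $ 1 * s $ 1))) * exp (- (\<i> * complex_of_real (x $ 2 * s $ 2)))"
      by (simp add: inner_vec_def sum_2 exp_add[symmetric] algebra_simps)
    show ?thesis unfolding heat_kernel_eq[OF assms] h_def e \<sigma>_def[symmetric] by simp
  qed
  show ?A unfolding eq using lborel_vec2_product(1)[OF h h] by (rule integrable_mult_right)
  have "exp (- (\<sigma> * (s $ 1))\<^sup>2 / 2) * exp (- (\<sigma> * (s $ 2))\<^sup>2 / 2) = exp (- (\<xi> * (norm s)\<^sup>2))"
    by (simp add: exp_add[symmetric] power_mult_distrib \<sigma> norm_real2 algebra_simps)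
  moreover have "integral\<^sup>L lborel (h t) = complex_of_real (exp (- (\<sigma> * t)\<^sup>2 / 2))" for t
    unfolding h_def by (rule fourier_normal_density[OF \<sigma>(1)])
  ultimately show ?B
    unfolding eq integral_mult_right_zero lborel_vec2_product(2)[OF h h]
    by (simp flip: of_real_mult)
qed

section \<open>From almost every point of the plane to almost every squared radius\<close>

text \<open>Fubini provides arbitrarily small \<open>a > 0\<close> such that the property holds at \<open>a\<^sup>2 + b\<^sup>2\<close> for almost
  every \<open>b\<close>; the exceptional \<open>r > a\<^sup>2\<close> are then the image of a null set under a smooth map.\<close>

lemma AE_radial_imp_AE:
  assumes "AE x in (lebesgue :: (real^2) measure). P ((norm x)\<^sup>2)"
  shows "AE r in lebesgue_on {0<..}. P r"
proof -
  have "AE x in lborel. P ((norm (x :: real^2))\<^sup>2)"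
    using assms by (simp add: AE_completion_iff)
  then have "AE p in lborel \<Otimes>\<^sub>M lborel. P ((norm (vec2 p))\<^sup>2)"
    unfolding lborel_eq_distr_vec2 by (rule AE_distrD[rotated]) simp
  then have ae: "AE a in lborel. AE b in lborel. P (a\<^sup>2 + b\<^sup>2)"
    by (drule_tac lborel_pair.AE_pair) (simp add: norm_real2)
  have neg: "negligible ({r. \<not> P r} \<inter> {\<delta><..})" if "\<delta> > 0" for \<delta>
  proof -
    have "\<exists>a. 0 < a \<and> a < sqrt \<delta> \<and> (AE b in lborel. P (a\<^sup>2 + b\<^sup>2))"
    proof (rule ccontr)
      assume n: "\<not> ?thesis"
      \<comment> \<open>Without a good \<open>a\<close>, the whole interval, of positive length,
        would lie in the exceptional null set of Fubini's theorem.\<close>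
      have "AE a in lborel. a \<notin> {0<..<sqrt \<delta>}"
        using ae by eventually_elim (use n in auto)
      then have "emeasure lborel {0<..<sqrt \<delta>} = 0"
        by (subst (asm) AE_iff_measurable[where N="{0<..<sqrt \<delta>}"]) auto
      then show False using that by simp
    qed
    then obtain a where a: "0 < a" "a < sqrt \<delta>" "AE b in lborel. P (a\<^sup>2 + b\<^sup>2)" by blast
    have "AE b in lebesgue. P (a\<^sup>2 + b\<^sup>2)" using a(3) by (simp add: AE_completion_iff)
    then have "negligible {b. \<not> P (a\<^sup>2 + b\<^sup>2)}"
      unfolding eventually_ae_filter_negligible by (blast intro: negligible_subset)
    then have "negligible ((\<lambda>b. a\<^sup>2 + b\<^sup>2) ` {b. \<not> P (a\<^sup>2 + b\<^sup>2)})"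
      by (rule negligible_differentiable_image_negligible[OF order_refl]) (auto intro!: derivative_intros simp: differentiable_on_def)
    moreover have "{r. \<not> P r} \<inter> {\<delta><..} \<subseteq> (\<lambda>b. a\<^sup>2 + b\<^sup>2) ` {b. \<not> P (a\<^sup>2 + b\<^sup>2)}"
    proof
      fix r assume r: "r \<in> {r. \<not> P r} \<inter> {\<delta><..}"
      have "a\<^sup>2 < (sqrt \<delta>)\<^sup>2" using a by (intro power_strict_mono) auto
      then have "a\<^sup>2 + (sqrt (r - a\<^sup>2))\<^sup>2 = r" using that r by simp
      then show "r \<in> (\<lambda>b. a\<^sup>2 + b\<^sup>2) ` {b. \<not> P (a\<^sup>2 + b\<^sup>2)}"
        using r by (intro image_eqI[of _ _ "sqrt (r - a\<^sup>2)"]) auto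
    qed
    ultimately show ?thesis by (rule negligible_subset)
  qed
  \<comment> \<open>Cutting at \<open>\<delta> = 1 / (n + 1)\<close> exhausts the half-line by
    countably many pieces.\<close>
  have "{r. \<not> P r} \<inter> {0<..} = (\<Union>n. {r. \<not> P r} \<inter> {inverse (real (Suc n))<..})"
    by (auto dest!: reals_Archimedean intro: less_trans[rotated] simp del: of_nat_Suc)
  moreover have "negligible (\<Union>n. {r. \<not> P r} \<inter> {inverse (real (Suc n))<..})"
    using neg by (intro negligible_countable_Union) auto
  ultimately have "negligible ({r. \<not> P r} \<inter> {0<..})" by simp
  then have "AE r in lebesgue. r \<notin> {r. \<not> P r} \<inter> {0<..}"
    unfolding negligible_iff_null_sets by (rule AE_not_in)
  then show ?thesis by (subst AE_restrict_space_iff) auto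
qed

section \<open>Time reversal of the control and exponential integrals over the control
  interval\<close>

text \<open>Composition with a general Borel map can destroy Lebesgue measurability. The reflection
  is affine, so it pulls Lebesgue sets back to Lebesgue sets, and it sends null sets to null sets;
  being its own inverse, it turns the exceptional set of \<open>u\<close> into that of the reversed
  control.\<close>

lemma reflected_control:
  fixes u :: "real \<Rightarrow> complex"
  assumes "u \<in> borel_measurable (lebesgue_on {0<..<T})"
    and "AE \<xi> in lebesgue_on {0<..<T}. norm (u \<xi>) \<le> L"
  shows "(\<lambda>\<xi>. u (T - \<xi>)) \<in> borel_measurable (lebesgue_on {0<..<T})"
    and "AE \<xi> in lebesgue_on {0<..<T}. norm (u (T - \<xi>)) \<le> L"
proof -
  have "(\<lambda>\<xi>. T - \<xi>) \<in> lebesgue \<rightarrow>\<^sub>M (lebesgue :: real measure)"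
    using lebesgue_affine_measurable[of "\<lambda>_. -1" T] by simp
  then have "(\<lambda>\<xi>. T - \<xi>) \<in> lebesgue_on {0<..<T} \<rightarrow>\<^sub>M lebesgue_on {0<..<T}"
    by (rule measurable_restrict_space3) auto
  then show "(\<lambda>\<xi>. u (T - \<xi>)) \<in> borel_measurable (lebesgue_on {0<..<T})"
    using assms(1) by (rule measurable_compose)
  have "AE \<xi> in lebesgue. \<xi> \<in> {0<..<T} \<longrightarrow> norm (u \<xi>) \<le> L"
    using assms(2) by (subst (asm) AE_restrict_space_iff) auto
  then obtain N where N: "negligible N" "{\<xi>. \<not> (\<xi> \<in> {0<..<T} \<longrightarrow> norm (u \<xi>) \<le> L)} \<subseteq> N"
    unfolding eventually_ae_filter_negligible by blast
  have "negligible ((\<lambda>\<xi>. T - \<xi>) ` N)"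
    using N(1) by (rule negligible_differentiable_image_negligible[OF order_refl])
      (auto intro!: derivative_intros simp: differentiable_on_def)
  moreover have "{\<xi>. \<not> (\<xi> \<in> {0<..<T} \<longrightarrow> norm (u (T - \<xi>)) \<le> L)} \<subseteq> (\<lambda>\<xi>. T - \<xi>) ` N"
  proof
    fix \<xi> assume "\<xi> \<in> {\<xi>. \<not> (\<xi> \<in> {0<..<T} \<longrightarrow> norm (u (T - \<xi>)) \<le> L)}"
    then have "T - \<xi> \<in> N" using N(2) by auto
    then show "\<xi> \<in> (\<lambda>\<xi>. T - \<xi>) ` N" by (rule rev_image_eqI) simp
  qed
  ultimately have "AE \<xi> in lebesgue. \<xi> \<in> {0<..<T} \<longrightarrow> norm (u (T - \<xi>)) \<le> L"
    unfolding eventually_ae_filter_negligible by blast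
  then show "AE \<xi> in lebesgue_on {0<..<T}. norm (u (T - \<xi>)) \<le> L"
    by (subst AE_restrict_space_iff) auto
qed

lemma integrable_exp_interval:
  "integrable (lebesgue_on {0<..<T}) (\<lambda>\<xi>. exp (r * \<xi> :: real))"
proof (rule finite_measure.integrable_const_bound)
  show "finite_measure (lebesgue_on {0<..<T})"
    by (rule finite_measure_lebesgue_on) simp
  show "AE \<xi> in lebesgue_on {0<..<T}. norm (exp (r * \<xi>)) \<le> exp (\<bar>r\<bar> * T)"
  proof (intro AE_I2)
    fix \<xi> assume "\<xi> \<in> space (lebesgue_on {0<..<T})"
    then have "r * \<xi> \<le> \<bar>r\<bar> * T"
      by (intro mult_mono) (auto simp: space_restrict_space)
    then show "norm (exp (r * \<xi>)) \<le> exp (\<bar>r\<bar> * T)" by simp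
  qed
  show "(\<lambda>\<xi>. exp (r * \<xi>)) \<in> borel_measurable (lebesgue_on {0<..<T})"
    by (intro continuous_imp_measurable_on_sets_lebesgue continuous_intros) simp
qed

text \<open>This integral is the source of the quotient in the final estimate. At
  \<open>r = 0\<close> the antiderivative breaks down and the constant integrand gives the limiting
  value \<open>T\<close>.\<close>

lemma integral_exp_interval:
  assumes "T > 0"
  shows "(LINT \<xi>|lebesgue_on {0<..<T}. exp (r * \<xi> :: real)) = (if r = 0 then T else (exp (T * r) - 1) / r)"
proof -
  have "((\<lambda>\<xi>. exp (r * \<xi>)) has_integral (if r = 0 then T else (exp (T * r) - 1) / r)) {0..T}"
  proof (cases "r = 0")
    case True
    then show ?thesis using has_integral_const_real[of "1 :: real" 0 T] assms by simp
  next
    case False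
    have "((\<lambda>\<xi>. exp (r * \<xi>)) has_integral exp (r * T) / r - exp (r * 0) / r) {0..T}"
      using assms False by (intro fundamental_theorem_of_calculus)
        (auto intro!: derivative_eq_intros simp: has_real_derivative_iff_has_vector_derivative[symmetric])
    then show ?thesis using False by (simp add: diff_divide_distrib mult.commute)
  qed
  then have "integral {0<..<T} (\<lambda>\<xi>. exp (r * \<xi>)) = (if r = 0 then T else (exp (T * r) - 1) / r)"
    unfolding integral_open_interval_real[symmetric] by (rule integral_unique)
  then show ?thesis
    using lebesgue_integral_eq_integral[OF integrable_exp_interval] by simp
qed

section \<open>The transfer function: growth and holomorphy\<close>

text \<open>Up to the factor \<open>- 1 / pi\<close>, a Laplace transform over a finite time
  interval.\<close>

definition transfer :: "real \<Rightarrow> (real \<Rightarrow> complex) \<Rightarrow> complex \<Rightarrow> complex" where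
  "transfer T w z = - (1 / complex_of_real pi) *
     (LINT \<xi>|lebesgue_on {0<..<T}. exp (- (z * complex_of_real \<xi>)) * w \<xi>)"

text \<open>The weight \<open>w\<close> plays the role of the time-reversed control \<open>\<lambda>\<xi>. u (T - \<xi>)\<close>.\<close>

locale bounded_control =
  fixes T L :: real and w :: "real \<Rightarrow> complex"
  assumes T: "T > 0"
    and w_measurable: "w \<in> borel_measurable (lebesgue_on {0<..<T})"
    and w_le_on: "AE \<xi> in lebesgue_on {0<..<T}. norm (w \<xi>) \<le> L"
begin

definition M :: "real measure" where
  "M = lebesgue_on {0<..<T}"

lemma w [measurable]: "w \<in> borel_measurable M"
  and w_le: "AE \<xi> in M. norm (w \<xi>) \<le> L"
  unfolding M_def by (rule w_measurable, rule w_le_on)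

lemma finite_measure_M: "finite_measure M"
  unfolding M_def by (rule finite_measure_lebesgue_on) simp

lemma id_measurable [measurable]: "(\<lambda>\<xi>. \<xi>) \<in> borel_measurable M"
  unfolding M_def by (simp add: measurable_completion measurable_restrict_space1)

lemma space_M: "\<xi> \<in> space M \<longleftrightarrow> 0 < \<xi> \<and> \<xi> < T"
  by (simp add: M_def space_restrict_space)

lemma norm_transfer_integrand:
  assumes "norm z \<le> r"
  shows "AE \<xi> in M. norm (exp (- (z * complex_of_real \<xi>)) * w \<xi>) \<le> L * exp (r * \<xi>)"
proof -
  have exp_le: "norm (exp (- (z * complex_of_real \<xi>))) \<le> exp (r * \<xi>)" if "\<xi> \<in> space M" for \<xi>
  proof -
    have "(- Re z) * \<xi> \<le> norm z * \<xi>"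
      using that abs_Re_le_cmod[of z] by (intro mult_right_mono) (auto simp: space_M)
    also have "\<dots> \<le> r * \<xi>" using assms that by (simp add: space_M mult_right_mono)
    finally show ?thesis by simp
  qed
  show ?thesis
    using w_le AE_space
  proof eventually_elim
    case (elim \<xi>)
    have "norm (exp (- (z * complex_of_real \<xi>))) * norm (w \<xi>) \<le> exp (r * \<xi>) * L"
      using elim exp_le by (intro mult_mono) auto
    then show ?case unfolding norm_mult by (simp only: mult.commute)
  qed
qed

lemma norm_transfer_le:
  assumes "norm z \<le> r"
  shows "norm (transfer T w z) \<le> L / pi * (if r = 0 then T else (exp (T * r) - 1) / r)"
proof -
  have int: "integrable M (\<lambda>\<xi>. L * exp (r * \<xi>))"
    unfolding M_def by (intro integrable_mult_right integrable_exp_interval)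
  note le = norm_transfer_integrand[OF assms]
  have "integrable M (\<lambda>\<xi>. exp (- (z * complex_of_real \<xi>)) * w \<xi>)"
    using int by (rule Bochner_Integration.integrable_bound) (use le in \<open>auto elim!: eventually_mono\<close>)
  then have "norm (LINT \<xi>|M. exp (- (z * complex_of_real \<xi>)) * w \<xi>) \<le> (LINT \<xi>|M. L * exp (r * \<xi>))"
    using int le by (intro order_trans[OF integral_norm_bound] integral_mono_AE integrable_norm)
  also have "\<dots> = L * (if r = 0 then T else (exp (T * r) - 1) / r)"
    by (simp add: M_def integral_exp_interval[OF T])
  finally have "norm (LINT \<xi>|M. exp (- (z * complex_of_real \<xi>)) * w \<xi>) / pi
      \<le> L * (if r = 0 then T else (exp (T * r) - 1) / r) / pi"
    by (intro divide_right_mono) auto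
  then show ?thesis
    unfolding transfer_def M_def[symmetric] by (simp add: norm_mult norm_divide)
qed

text \<open>Expand the exponential and integrate term by term. As \<open>\<xi> < T\<close>, the n-th
  term is at most \<open>(norm z * T) ^ n / fact n * L\<close>, summable even after integration over
  a set of finite measure. Having this expansion at every \<open>z\<close> makes the function
  entire.\<close>

lemma transfer_sums:
  "(\<lambda>n. - (1 / complex_of_real pi) * (LINT \<xi>|M. (- complex_of_real \<xi>) ^ n / fact n * w \<xi>) * z ^ n)
     sums transfer T w z"
proof -
  define f where "f n \<xi> = (- (z * complex_of_real \<xi>)) ^ n / fact n * w \<xi>" for n \<xi>
  have [measurable]: "f n \<in> borel_measurable M" for n
    unfolding f_def by measurable
  have f_le: "AE \<xi> in M. norm (f n \<xi>) \<le> (norm z * T) ^ n / fact n * L" for n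
    using w_le AE_space
  proof eventually_elim
    case (elim \<xi>)
    have "norm ((- (z * complex_of_real \<xi>)) ^ n / fact n) \<le> (norm z * T) ^ n / fact n"
      using elim by (auto simp: norm_divide norm_power norm_mult space_M intro!: divide_right_mono power_mono mult_left_mono)
    then show ?case
      using elim T unfolding f_def norm_mult by (intro mult_mono) auto
  qed
  have int: "integrable M (f n)" for n
    using f_le by (intro finite_measure.integrable_const_bound[OF finite_measure_M]) auto
  have exp_sums: "(\<lambda>n. f n \<xi>) sums (exp (- (z * complex_of_real \<xi>)) * w \<xi>)" for \<xi>
    unfolding f_def using exp_converges[of "- (z * complex_of_real \<xi>)"]
    by (intro sums_mult2) (simp add: scaleR_conv_of_real divide_inverse mult.commute)
  have "(\<lambda>n. integral\<^sup>L M (f n)) sums (\<integral>\<xi>. (\<Sum>n. f n \<xi>) \<partial>M)"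
  proof (rule sums_integral[OF int])
    show "AE \<xi> in M. summable (\<lambda>n. norm (f n \<xi>))"
    proof (intro AE_I2)
      fix \<xi>
      have "summable (\<lambda>n. norm ((- (z * complex_of_real \<xi>)) ^ n /\<^sub>R fact n) * norm (w \<xi>))"
        by (intro summable_mult2 summable_norm_exp)
      then show "summable (\<lambda>n. norm (f n \<xi>))"
        by (simp add: f_def norm_mult norm_divide divide_inverse norm_inverse mult_ac)
    qed
    have "summable (\<lambda>n. (norm z * T) ^ n / fact n * L * measure M (space M))"
      using summable_exp_generic[of "norm z * T"]
      by (intro summable_mult2) (simp add: divide_inverse mult.commute)
    then show "summable (\<lambda>n. \<integral>\<xi>. norm (f n \<xi>) \<partial>M)"
    proof (rule summable_comparison_test')
      fix n :: nat assume "0 \<le> n"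
      have "(\<integral>\<xi>. norm (f n \<xi>) \<partial>M) \<le> (\<integral>\<xi>. (norm z * T) ^ n / fact n * L \<partial>M)"
        using f_le int finite_measure.integrable_const[OF finite_measure_M] by (intro integral_mono_AE) auto
      then show "norm (\<integral>\<xi>. norm (f n \<xi>) \<partial>M) \<le> (norm z * T) ^ n / fact n * L * measure M (space M)"
        by (simp add: mult_ac)
    qed
  qed
  then have "(\<lambda>n. - (1 / complex_of_real pi) * integral\<^sup>L M (f n)) sums transfer T w z"
    unfolding transfer_def M_def[symmetric] sums_unique[OF exp_sums, symmetric] by (rule sums_mult)
  moreover have "integral\<^sup>L M (f n) = (LINT \<xi>|M. (- complex_of_real \<xi>) ^ n / fact n * w \<xi>) * z ^ n" for n
  proof -
    have "f n = (\<lambda>\<xi>. (- complex_of_real \<xi>) ^ n / fact n * w \<xi> * z ^ n)"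
      unfolding f_def fun_eq_iff mult_minus_right[symmetric] power_mult_distrib by simp
    then show ?thesis by simp
  qed
  ultimately show ?thesis by (simp add: mult.assoc)
qed

lemma transfer_holomorphic: "transfer T w holomorphic_on UNIV"
proof -
  have "transfer T w holomorphic_on ball 0 r" for r
    using transfer_sums by (intro power_series_holomorphic[where a="\<lambda>n. - (1 / complex_of_real pi) * (LINT \<xi>|M. (- complex_of_real \<xi>) ^ n / fact n * w \<xi>)"]) simp
  then have "transfer T w holomorphic_on (\<Union>r. ball 0 r)"
    by (subst holomorphic_on_UN_open) auto
  moreover have "(\<Union>r. ball (0 :: complex) r) = UNIV"
    by (auto intro: gt_ex)
  ultimately show ?thesis by simp
qed

section \<open>Fourier transform of the heat potential\<close>

text \<open>The factor \<open>1 / (2 * \<xi>)\<close> is singular at 0, but the kernel has the same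
  total mass \<open>2 * pi\<close> at every time. Integrating the norm over the plane first leaves
  \<open>2 * pi * norm (w \<xi>)\<close>, which is bounded almost everywhere.\<close>

lemma heat_kernel_control_integrable:
  "integrable (M \<Otimes>\<^sub>M lborel)
     (\<lambda>(\<xi>, x). complex_of_real (heat_kernel \<xi> x) * w \<xi> * exp (- (\<i> * complex_of_real (x \<bullet> s))))"
proof -
  interpret finite_measure M by (rule finite_measure_M)
  interpret pair_sigma_finite M "lborel :: (real^2) measure" ..
  have [measurable]: "(\<lambda>p. fst p) \<in> borel_measurable (M \<Otimes>\<^sub>M (lborel :: (real^2) measure))"
    by (rule measurable_compose[OF measurable_fst id_measurable])
  have nonneg: "0 \<le> heat_kernel \<xi> x" if "\<xi> \<in> space M" for \<xi> x
    using that by (simp add: heat_kernel_def space_M)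
  show ?thesis
  proof (rule Fubini_integrable)
    show "(\<lambda>(\<xi>, x). complex_of_real (heat_kernel \<xi> x) * w \<xi> * exp (- (\<i> * complex_of_real (x \<bullet> s))))
        \<in> borel_measurable (M \<Otimes>\<^sub>M lborel)"
      unfolding heat_kernel_def case_prod_beta' by measurable
    have eq: "(\<integral>x. norm (case (\<xi>, x) of (\<xi>, x) \<Rightarrow> complex_of_real (heat_kernel \<xi> x) * w \<xi> * exp (- (\<i> * complex_of_real (x \<bullet> s)))) \<partial>lborel)
        = 2 * pi * norm (w \<xi>)" if "\<xi> \<in> space M" for \<xi>
    proof -
      \<comment> \<open>The total mass is the Fourier integral at frequency 0.\<close>
      have "complex_of_real (\<integral>x. heat_kernel \<xi> x \<partial>lborel) = complex_of_real (2 * pi)"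
        using heat_kernel_fourier(2)[of \<xi> 0] that by (simp add: space_M)
      then have "(\<integral>x. heat_kernel \<xi> x \<partial>lborel) = 2 * pi"
        unfolding of_real_eq_iff .
      then show ?thesis using nonneg[OF that] by (simp add: norm_mult)
    qed
    have "integrable M (\<lambda>\<xi>. 2 * pi * norm (w \<xi>))"
      using w_le by (intro integrable_mult_right integrable_norm integrable_const_bound[where B=L]) auto
    then show "integrable M (\<lambda>\<xi>. \<integral>x. norm (case (\<xi>, x) of (\<xi>, x) \<Rightarrow>
        complex_of_real (heat_kernel \<xi> x) * w \<xi> * exp (- (\<i> * complex_of_real (x \<bullet> s)))) \<partial>lborel)"
      by (simp only: eq cong: Bochner_Integration.integrable_cong)
    show "AE \<xi> in M. integrable lborel (\<lambda>x. case (\<xi>, x) of (\<xi>, x) \<Rightarrow>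
        complex_of_real (heat_kernel \<xi> x) * w \<xi> * exp (- (\<i> * complex_of_real (x \<bullet> s))))"
    proof (intro AE_I2)
      fix \<xi> assume "\<xi> \<in> space M"
      then have "integrable lborel (\<lambda>x. w \<xi> * (complex_of_real (heat_kernel \<xi> x) * exp (- (\<i> * complex_of_real (x \<bullet> s)))))"
        by (intro integrable_mult_right heat_kernel_fourier) (simp add: space_M)
      then show "integrable lborel (\<lambda>x. case (\<xi>, x) of (\<xi>, x) \<Rightarrow>
        complex_of_real (heat_kernel \<xi> x) * w \<xi> * exp (- (\<i> * complex_of_real (x \<bullet> s))))"
        by (simp add: mult_ac)
    qed
  qed
qed

lemma heat_potential_fourier:
  fixes W :: "real^2 \<Rightarrow> complex"
  defines "W \<equiv> \<lambda>x. - (1 / complex_of_real pi) * (LINT \<xi>|M. complex_of_real (heat_kernel \<xi> x) * w \<xi>)"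
  shows "integrable lebesgue W"
    and "fourier_integral W s = transfer T w (complex_of_real ((norm s)\<^sup>2))"
proof -
  interpret finite_measure M by (rule finite_measure_M)
  interpret pair_sigma_finite M "lborel :: (real^2) measure" ..
  note int = heat_kernel_control_integrable
  \<comment> \<open>At \<open>s = 0\<close> the oscillating factor is 1, so Fubini gives
    integrability of \<open>W\<close> itself.\<close>
  have W: "integrable lborel W"
    unfolding W_def using integrable_snd[OF int[of 0]] by simp
  then show "integrable lebesgue W" by (subst integrable_completion) auto
  have "(LINT x|lebesgue. W x * exp (- (\<i> * complex_of_real (x \<bullet> s))))
      = (LINT x|lborel. W x * exp (- (\<i> * complex_of_real (x \<bullet> s))))"
    using W by (intro integral_completion) simp
  also have "\<dots> = (LINT x|lborel. - (1 / complex_of_real pi) *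
      (LINT \<xi>|M. complex_of_real (heat_kernel \<xi> x) * w \<xi> * exp (- (\<i> * complex_of_real (x \<bullet> s)))))"
    by (simp add: W_def)
  also have "\<dots> = - (1 / complex_of_real pi) * (LINT \<xi>|M. (LINT x|lborel.
      complex_of_real (heat_kernel \<xi> x) * w \<xi> * exp (- (\<i> * complex_of_real (x \<bullet> s)))))"
    using Fubini_integral[OF int[of s]] by simp
  also have "(LINT \<xi>|M. (LINT x|lborel.
      complex_of_real (heat_kernel \<xi> x) * w \<xi> * exp (- (\<i> * complex_of_real (x \<bullet> s)))))
      = (LINT \<xi>|M. 2 * complex_of_real pi * (exp (- (complex_of_real ((norm s)\<^sup>2) * complex_of_real \<xi>)) * w \<xi>))"
  proof (intro Bochner_Integration.integral_cong refl)
    fix \<xi> assume "\<xi> \<in> space M"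
    then have "(LINT x|lborel. w \<xi> * (complex_of_real (heat_kernel \<xi> x) * exp (- (\<i> * complex_of_real (x \<bullet> s)))))
        = w \<xi> * complex_of_real (2 * pi * exp (- (\<xi> * (norm s)\<^sup>2)))"
      by (subst integral_mult_right_zero, subst heat_kernel_fourier) (simp_all add: space_M)
    then show "(LINT x|lborel. complex_of_real (heat_kernel \<xi> x) * w \<xi> * exp (- (\<i> * complex_of_real (x \<bullet> s))))
        = 2 * complex_of_real pi * (exp (- (complex_of_real ((norm s)\<^sup>2) * complex_of_real \<xi>)) * w \<xi>)"
      by (simp add: mult_ac exp_of_real[symmetric])
  qed
  finally show "fourier_integral W s = transfer T w (complex_of_real ((norm s)\<^sup>2))"
    by (simp add: fourier_integral_def transfer_def M_def)
qed

end

section \<open>Agreement of the Plancherel transform with the Fourier integral\<close>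

text \<open>The oscillating factor has modulus 1, so \<open>norm (g x)\<close> dominates. Continuity
  supplies the measurability of the truncated transforms required by Fatou's lemma.\<close>

lemma continuous_fourier_integral:
  assumes "integrable lebesgue g"
  shows "continuous_on UNIV (fourier_integral g)"
proof (rule continuous_on_sequentiallyI)
  fix X :: "nat \<Rightarrow> real^2" and \<sigma> assume X: "X \<longlonglongrightarrow> \<sigma>"
  have [measurable]: "(\<lambda>x. exp (- (\<i> * complex_of_real (x \<bullet> s)))) \<in> borel_measurable (lebesgue :: (real^2) measure)" for s
    by (intro measurable_completion) simp
  have "(\<lambda>n. LINT x|lebesgue. g x * exp (- (\<i> * complex_of_real (x \<bullet> X n))))
      \<longlonglongrightarrow> (LINT x|lebesgue. g x * exp (- (\<i> * complex_of_real (x \<bullet> \<sigma>))))"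
  proof (rule integral_dominated_convergence[where w="\<lambda>x. norm (g x)"])
    show "AE x in lebesgue. (\<lambda>n. g x * exp (- (\<i> * complex_of_real (x \<bullet> X n))))
        \<longlonglongrightarrow> g x * exp (- (\<i> * complex_of_real (x \<bullet> \<sigma>)))"
      using X by (intro AE_I2 tendsto_intros)
  qed (use assms in \<open>auto simp: norm_mult\<close>)
  then show "(\<lambda>n. fourier_integral g (X n)) \<longlonglongrightarrow> fourier_integral g \<sigma>"
    unfolding fourier_integral_def by (rule tendsto_mult_left)
qed

text \<open>The truncated integrals converge pointwise, and Fatou's lemma identifies this limit with the
  limit in \<open>L\<^sup>2\<close> without passing to subsequences.\<close>

lemma fourier_L2_eq_integral:
  assumes f: "integrable lebesgue f" and F: "fourier_L2 f F"
  shows "AE \<sigma> in lebesgue. F \<sigma> = fourier_integral f \<sigma>"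
proof -
  define \<Phi> where "\<Phi> n = fourier_integral (\<lambda>x. indicator (cball 0 (real n)) x * f x)" for n :: nat
  have meas_F [measurable]: "F \<in> borel_measurable lebesgue"
    using F by (simp add: fourier_L2_def L2_on_def)
  have int: "integrable lebesgue (\<lambda>x. indicator (cball 0 R) x * f x)" for R :: real
  proof -
    have eq: "(\<lambda>x. indicator (cball 0 R) x * f x) = (\<lambda>x. indicator (cball 0 R) x *\<^sub>R f x)"
      by (auto simp: indicator_def fun_eq_iff)
    show ?thesis unfolding eq by (rule integrable_mult_indicator[OF _ f]) simp
  qed
  have [measurable]: "\<Phi> n \<in> borel_measurable lebesgue" for n
    unfolding \<Phi>_def using continuous_fourier_integral[OF int]
    by (intro measurable_completion) (simp add: borel_measurable_continuous_onI)
  have [measurable]: "(\<lambda>x. exp (- (\<i> * complex_of_real (x \<bullet> s)))) \<in> borel_measurable (lebesgue :: (real^2) measure)" for s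
    by (intro measurable_completion) simp
  have lim: "(\<lambda>n. \<Phi> n \<sigma>) \<longlonglongrightarrow> fourier_integral f \<sigma>" for \<sigma>
    unfolding \<Phi>_def fourier_integral_def
  proof (intro tendsto_mult_left integral_dominated_convergence[where w="\<lambda>x. norm (f x)"])
    show "AE x in lebesgue. (\<lambda>n. indicator (cball 0 (real n)) x * f x * exp (- (\<i> * complex_of_real (x \<bullet> \<sigma>))))
        \<longlonglongrightarrow> f x * exp (- (\<i> * complex_of_real (x \<bullet> \<sigma>)))"
    proof (intro AE_I2 tendsto_eventually)
      fix x :: "real^2"
      have "\<forall>\<^sub>F n in sequentially. norm x \<le> real n"
        using eventually_ge_at_top[of "nat \<lceil>norm x\<rceil>"] by eventually_elim linarith
      then show "\<forall>\<^sub>F n in sequentially. indicator (cball 0 (real n)) x * f x * exp (- (\<i> * complex_of_real (x \<bullet> \<sigma>)))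
          = f x * exp (- (\<i> * complex_of_real (x \<bullet> \<sigma>)))"
        by eventually_elim simp
    qed
    show "AE x in lebesgue. norm (indicator (cball 0 (real n)) x * f x * exp (- (\<i> * complex_of_real (x \<bullet> \<sigma>)))) \<le> norm (f x)" for n
      by (simp add: norm_mult indicator_def)
  qed (use f int in auto)
  have "(\<integral>\<^sup>+ \<sigma>. ennreal ((norm (fourier_integral f \<sigma> - F \<sigma>))\<^sup>2) \<partial>lebesgue)
      = (\<integral>\<^sup>+ \<sigma>. liminf (\<lambda>n. ennreal ((norm (\<Phi> n \<sigma> - F \<sigma>))\<^sup>2)) \<partial>lebesgue)"
    by (intro nn_integral_cong lim_imp_Liminf[symmetric] tendsto_ennrealI tendsto_intros lim) simp
  also have "\<dots> \<le> liminf (\<lambda>n. \<integral>\<^sup>+ \<sigma>. ennreal ((norm (\<Phi> n \<sigma> - F \<sigma>))\<^sup>2) \<partial>lebesgue)"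
    by (rule nn_integral_liminf) measurable
  \<comment> \<open>The limit over real radii is restricted to integer radii.\<close>
  also have "\<dots> = 0"
    using F unfolding \<Phi>_def fourier_L2_def
    by (intro lim_imp_Liminf filterlim_compose[OF _ filterlim_real_sequentially]) auto
  finally have nn0: "(\<integral>\<^sup>+ \<sigma>. ennreal ((norm (fourier_integral f \<sigma> - F \<sigma>))\<^sup>2) \<partial>lebesgue) = 0"
    by simp
  have "fourier_integral f \<in> borel_measurable lebesgue"
    using continuous_fourier_integral[OF f] by (intro measurable_completion) (simp add: borel_measurable_continuous_onI)
  then have "AE \<sigma> in lebesgue. ennreal ((norm (fourier_integral f \<sigma> - F \<sigma>))\<^sup>2) = 0"
    using nn0 by (subst (asm) nn_integral_0_iff_AE) auto
  then show ?thesis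
    by eventually_elim (simp add: ennreal_eq_0_iff)
qed

lemma fourier_integral_cong_AE:
  assumes "AE x in lebesgue. f x = g x" "f \<in> borel_measurable lebesgue" "g \<in> borel_measurable lebesgue"
  shows "fourier_integral f = fourier_integral g"
proof
  fix s
  have [measurable]: "(\<lambda>x. exp (- (\<i> * complex_of_real (x \<bullet> s)))) \<in> borel_measurable (lebesgue :: (real^2) measure)"
    by (intro measurable_completion) simp
  have "(LINT x|lebesgue. f x * exp (- (\<i> * complex_of_real (x \<bullet> s)))) = (LINT x|lebesgue. g x * exp (- (\<i> * complex_of_real (x \<bullet> s))))"
    using assms by (intro integral_cong_AE) (auto elim: eventually_mono)
  then show "fourier_integral f s = fourier_integral g s"
    by (simp add: fourier_integral_def)
qed

section \<open>Composition with the complex sum of squares, and the growth estimate\<close>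

lemma norm_complex2: "(norm (s :: complex^2))\<^sup>2 = (norm (s $ 1))\<^sup>2 + (norm (s $ 2))\<^sup>2"
  by (simp add: norm_vec_def L2_set_def sum_2)

text \<open>This inequality turns order 1 in one variable into order 2 in two variables with the
  same type.\<close>

lemma norm_sum_squares_le: "norm ((s $ 1)\<^sup>2 + (s $ 2)\<^sup>2) \<le> (norm (s :: complex^2))\<^sup>2"
  unfolding norm_complex2 by (rule order_trans[OF norm_triangle_ineq]) (simp add: norm_power)

text \<open>By the chain rule the derivative is multiplication by E' after the differential of a
  polynomial, hence complex-linear.\<close>

lemma entire_several_sum_squares:
  assumes "E holomorphic_on UNIV"
  shows "entire_several (\<lambda>s :: complex^2. E ((s $ 1)\<^sup>2 + (s $ 2)\<^sup>2))"
  unfolding entire_several_def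
proof
  fix z :: "complex^2"
  define q where "q s = (s $ 1)\<^sup>2 + (s $ 2)\<^sup>2" for s :: "complex^2"
  have E: "(E has_field_derivative deriv E (q z)) (at (q z))"
    using assms by (simp add: holomorphic_derivI)
  have q: "(q has_derivative (\<lambda>h. 2 * z $ 1 * h $ 1 + 2 * z $ 2 * h $ 2)) (at z)"
    unfolding q_def by (auto intro!: derivative_eq_intros bounded_linear.has_derivative[OF bounded_linear_vec_nth])
  have "((\<lambda>s. E (q s)) has_derivative (\<lambda>h. deriv E (q z) * (2 * z $ 1 * h $ 1 + 2 * z $ 2 * h $ 2))) (at z)"
    using has_derivative_compose[OF q, of E] E by (simp add: has_field_derivative_def)
  then show "\<exists>D. ((\<lambda>s. E ((s $ 1)\<^sup>2 + (s $ 2)\<^sup>2)) has_derivative D) (at z) \<and> (\<forall>c h. D (c *s h) = c * D h)"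
    unfolding q_def by (intro exI conjI, assumption) (simp add: algebra_simps)
qed

text \<open>Multiply \<open>1 - x \<le> exp (- x)\<close> by \<open>exp x\<close>, with
  \<open>x = T * r\<close>. The sharp quotient thereby yields an exponential bound of type
  \<open>T\<close>.\<close>

lemma exp_quotient_le:
  fixes r T :: real
  assumes "r \<ge> 0" "T > 0"
  shows "(if r = 0 then T else (exp (T * r) - 1) / r) \<le> T * exp (T * r)"
proof (cases "r = 0")
  case False
  have "exp (T * r) * (1 + - (T * r)) \<le> exp (T * r) * exp (- (T * r))"
    by (intro mult_left_mono exp_ge_add_one_self) simp
  then have "exp (T * r) - 1 \<le> T * exp (T * r) * r"
    by (simp add: exp_minus algebra_simps)
  then show ?thesis using False assms by (simp add: divide_le_eq)
qed simp

section \<open>Assembly of both extensions from the reversed control\<close>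

theorem theorem3p7:
  fixes L T :: real
    and f F :: "real^2 \<Rightarrow> complex"
    and G :: "real \<Rightarrow> complex"
  assumes "L > 0" and "T > 0"
    and "f \<in> reachable_from_0 L T"
    and "fourier_L2 f F"
    and "radial_profile F G"
  shows "\<exists>Ge :: complex \<Rightarrow> complex.
           Ge holomorphic_on UNIV \<and>
           (AE r in lebesgue_on {0<..}. Ge (complex_of_real r) = G r) \<and>
           order_type_le Ge 1 T \<and>
           (\<exists>Fe :: complex^2 \<Rightarrow> complex.
              entire_several Fe \<and>
              (AE x in lebesgue. Fe (\<chi> i. complex_of_real (x $ i)) = F x) \<and>
              (\<forall>s. Fe s = Ge ((s $ 1)\<^sup>2 + (s $ 2)\<^sup>2)) \<and>
              order_type_le Fe 2 T \<and>
              (\<forall>s. norm (Fe s) \<le> norm (Ge ((s $ 1)\<^sup>2 + (s $ 2)\<^sup>2)) \<and>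
                   norm (Ge ((s $ 1)\<^sup>2 + (s $ 2)\<^sup>2))
                     \<le> L / pi * (if s = 0 then T
                                 else (exp (T * (norm s)\<^sup>2) - 1) / (norm s)\<^sup>2)))"
proof -
  obtain u where u: "u \<in> borel_measurable (lebesgue_on {0<..<T})"
      "Linf_norm (lebesgue_on {0<..<T}) u \<le> ereal L"
    and fu: "AE x in lebesgue. f x = heat_control u x T"
    using assms(3) by (auto simp: reachable_from_0_def Linf_on_def)
  have u_le: "AE \<xi> in lebesgue_on {0<..<T}. norm (u \<xi>) \<le> L"
    using esssup_AE[of "\<lambda>\<xi>. ereal (norm (u \<xi>))" "lebesgue_on {0<..<T}"]
  proof eventually_elim
    case (elim \<xi>)
    then have "ereal (norm (u \<xi>)) \<le> ereal L"
      using u(2) unfolding Linf_norm_def by (rule order_trans)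
    then show ?case by simp
  qed
  interpret bounded_control T L "\<lambda>\<xi>. u (T - \<xi>)"
    by unfold_locales (fact assms(2), (rule reflected_control[OF u(1) u_le])+)
  define Ge where "Ge = transfer T (\<lambda>\<xi>. u (T - \<xi>))"
  define Fe where "Fe s = Ge ((s $ 1)\<^sup>2 + (s $ 2)\<^sup>2)" for s :: "complex^2"
  have hc: "heat_control u = (\<lambda>x T. - (1 / complex_of_real pi) *
      (LINT \<xi>|lebesgue_on {0<..<T}. complex_of_real (heat_kernel \<xi> x) * u (T - \<xi>)))"
    by (simp add: heat_control_def heat_kernel_def fun_eq_iff)
  note fourier = heat_potential_fourier[unfolded M_def]
  have f: "f \<in> borel_measurable lebesgue"
    using assms(4) by (simp add: fourier_L2_def L2_on_def)
  have W: "integrable lebesgue (\<lambda>x. heat_control u x T)"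
    unfolding hc by (rule fourier(1))
  have f_int: "integrable lebesgue f"
    using integrable_cong_AE[THEN iffD2, OF f _ fu] W by auto
  have "fourier_integral f s = Ge (complex_of_real ((norm s)\<^sup>2))" for s
    using fourier_integral_cong_AE[OF fu f] W fourier(2)[of s] by (auto simp: hc Ge_def)
  then have F: "AE s in lebesgue. F s = Ge (complex_of_real ((norm s)\<^sup>2))"
    using fourier_L2_eq_integral[OF f_int assms(4)] by simp
  have "AE s in lebesgue. F s = G ((norm s)\<^sup>2)"
    using assms(5) by (simp add: radial_profile_def)
  \<comment> \<open>\<open>F\<close> now has two radial descriptions, one through \<open>Ge\<close>
    and one through \<open>G\<close>; comparing them transfers the extension to the profile.\<close>
  with F have "AE s in (lebesgue :: (real^2) measure). Ge (complex_of_real ((norm s)\<^sup>2)) = G ((norm s)\<^sup>2)"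
    by eventually_elim simp
  then have G: "AE r in lebesgue_on {0<..}. Ge (complex_of_real r) = G r"
    by (rule AE_radial_imp_AE)
  have hol: "Ge holomorphic_on UNIV"
    unfolding Ge_def by (rule transfer_holomorphic)
  \<comment> \<open>One constant, \<open>L / pi * T\<close>, serves every \<epsilon>. Taking
    \<open>r\<close> as \<open>norm z\<close> gives the growth of \<open>Ge\<close>, and as
    \<open>(norm s)\<^sup>2\<close> that of \<open>Fe\<close>.\<close>
  have bound: "norm (Ge z) \<le> L / pi * T * exp ((T + \<epsilon>) * r)" if "norm z \<le> r" "\<epsilon> > 0" for z r \<epsilon>
  proof -
    have r: "0 \<le> r" using norm_ge_zero that(1) by (rule order_trans)
    have "norm (Ge z) \<le> L / pi * (if r = 0 then T else (exp (T * r) - 1) / r)"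
      unfolding Ge_def by (rule norm_transfer_le[OF that(1)])
    also have "\<dots> \<le> L / pi * (T * exp (T * r))"
      using assms r by (intro mult_left_mono exp_quotient_le) auto
    also have "\<dots> \<le> L / pi * (T * exp ((T + \<epsilon>) * r))"
      using assms r that by (intro mult_left_mono) (auto simp: distrib_right)
    finally show ?thesis by (simp add: mult.assoc)
  qed
  have Ge_order: "order_type_le Ge 1 T"
    unfolding order_type_le_def
  proof (intro allI impI exI)
    fix \<epsilon> :: real and z assume "\<epsilon> > 0"
    then show "norm (Ge z) \<le> L / pi * T * exp ((T + \<epsilon>) * norm z powr 1)"
      using bound[OF order_refl] by simp
  qed
  have Fe_order: "order_type_le Fe 2 T"
    unfolding order_type_le_def Fe_def
  proof (intro allI impI exI)
    fix \<epsilon> :: real and s :: "complex^2" assume "\<epsilon> > 0"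
    then show "norm (Ge ((s $ 1)\<^sup>2 + (s $ 2)\<^sup>2)) \<le> L / pi * T * exp ((T + \<epsilon>) * norm s powr 2)"
      using bound[OF norm_sum_squares_le] by simp
  qed
  \<comment> \<open>At real points the complex sum of squares is
    \<open>(norm x)\<^sup>2\<close>.\<close>
  have FeF: "AE x in lebesgue. Fe (\<chi> i. complex_of_real (x $ i)) = F x"
    using F by eventually_elim (simp add: Fe_def norm_real2)
  have "norm (Ge ((s $ 1)\<^sup>2 + (s $ 2)\<^sup>2))
      \<le> L / pi * (if s = 0 then T else (exp (T * (norm s)\<^sup>2) - 1) / (norm s)\<^sup>2)" for s :: "complex^2"
    using norm_transfer_le[OF norm_sum_squares_le[of s]] by (simp add: Ge_def)
  then show ?thesis
    using hol G Ge_order entire_several_sum_squares[OF hol] FeF Fe_order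
    by (intro exI[of _ Ge] conjI exI[of _ Fe]) (auto simp: Fe_def[abs_def])
qed

end
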